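(* Let $F:\mathscr{D}(F)\subseteq U\to H$ and $h$ satisfy (A1)–(A7) of the context, and let $\bar u$, $\xi\in\partial h(\bar u)$, $\rho>0$ and $c>0$ satisfy the nonlinearity assumption (N) of the context. Assume moreover that there exists $\omega\in H^*$ such that $\xi=F'(\bar u)^*\omega\in\partial h(\bar u)$ and $c\,\|\omega\|_{H^*}<1$. Let $\alpha>0$ and let $u_\alpha$ be a minimizer of the Tikhonov functional with exact data, $J_\alpha(u)=\frac12\|F(u)-y\|^2+\alpha h(u)$. Then $$\|F(u_\alpha)-F(\bar u)\|\le 4\alpha\|\omega\|_{H^*},\qquad D_h^{F'(\bar u)^*\omega}(u_\alpha,\bar u)\le\frac{4\alpha\|\omega\|_{H^*}^2}{1-c\|\omega\|_{H^*}}.$$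
   Context: $U,H$ are (infinite-dimensional) Banach spaces with duals $U^*,H^*$; $\langle\cdot,\cdot\rangle$ is the duality pairing; $y\in H$ is the exact datum of the equation $F(u)=y$. Standing assumptions. (A1) $U$ and $H$ carry topologies $\tau_U$ and $\tau_H$, respectively, weaker than the norm topologies. (A2) The topological duals of $U$, $H$ are denoted $U^*$, $H^*$. (A3) The norm of $H$ is sequentially lower semicontinuous with respect to $\tau_H$. (A4) $\mathscr{D}(F)$ has non-empty interior in the norm topology and is $\tau_U$-closed; $\mathscr{D}(F)\cap\operatorname{dom}h\ne\emptyset$. (A5) $F:\mathscr{D}(F)\subseteq U\to H$ is continuous from $(U,\tau_U)$ to $(H,\tau_H)$. (A6) $h:U\to[0,+\infty]$ is proper, convex, bounded from below and $\tau_U$-lower semicontinuous; $\operatorname{dom}h=\{u: h(u)<\infty\}$. (A7) For all $M>0$, $\alpha>0$ the set $\{u : J_\alpha(u)\le M\}$ is $\tau_U$-compact in the sense that every sequence in it has a $\tau_U$-convergent subsequence. Here $J_\alpha$ is considered on $\mathscr{D}(F)$. $h$-minimizing solution: $\bar u\in\operatorname{dom}h\cap\mathscr{D}(F)$ with $F(\bar u)=y$ that minimizes $h$ among all $u$ with $F(u)=y$. Bregman distance: for $u,v\in\operatorname{dom}h$ and $\xi\in\partial h(u)\subseteq U^*$ (subdifferential), $D_h^\xi(v,u)=h(v)-h(u)-\langle\xi,v-u\rangle$. Assumption (N): an $h$-minimizing solution $\bar u$ of $F(u)=y$ exists, $F$ is Gâteaux differentiable, and there are $\rho>0$, $c>0$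 and $\xi\in\partial h(\bar u)$ such that for every $u\in\mathscr{D}(F)\cap B_\rho(\bar u)$ ($B_\rho(\bar u)$ the ball of radius $\rho$ around $\bar u$) $$\|F(u)-F(\bar u)-F'(\bar u)(u-\bar u)\|\le c\,D_h^\xi(u,\bar u).$$ $F'(\bar u):U\to H$ is the (linear) derivative and $F'(\bar u)^*:H^*\to U^*$ its adjoint.
   Formalization: The minimizer u_α is additionally assumed to lie in the (open) ball B_ρ(ū) on which the nonlinearity assumption (N) is required; without this the claim is false, since (N) is only local and minimizers may lie near a different solution. *)

theory Defs
  imports "HOL-Analysis.Analysis"
begin

text \<open>The dual of a real normed space \<open>'a\<close> is the type \<open>'a \<Rightarrow>\<^sub>L real\<close>; its norm is the operator norm.
  A partially defined \<open>F : D \<subseteq> U \<rightarrow> H\<close> is a total function together with the set \<open>D\<close>; the values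
  of \<open>F\<close> outside \<open>D\<close> play no role.\<close>

definition dual_adjoint ::
    "('u::real_normed_vector \<Rightarrow>\<^sub>L 'h::real_normed_vector) \<Rightarrow> ('h \<Rightarrow>\<^sub>L real) \<Rightarrow> ('u \<Rightarrow>\<^sub>L real)" where
  "dual_adjoint A \<omega> = \<omega> o\<^sub>L A"

definition coarser_than_norm :: "'a::real_normed_vector topology \<Rightarrow> bool" where
  "coarser_than_norm T \<longleftrightarrow> topspace T = UNIV \<and> (\<forall>S. openin T S \<longrightarrow> open S)"

definition seq_lsc_wrt :: "'a topology \<Rightarrow> ('a \<Rightarrow> ereal) \<Rightarrow> bool" where
  "seq_lsc_wrt T f \<longleftrightarrow>
     (\<forall>x l. limitin T x l sequentially \<longrightarrow> f l \<le> liminf (\<lambda>n. f (x n)))"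

definition lsc_wrt :: "'a topology \<Rightarrow> ('a \<Rightarrow> ereal) \<Rightarrow> bool" where
  "lsc_wrt T f \<longleftrightarrow> (\<forall>a. openin T {x \<in> topspace T. a < f x})"

text \<open>As in the hypothesis it models, the limit is not required to lie in \<open>S\<close>.\<close>

definition seq_compact_wrt :: "'a topology \<Rightarrow> 'a set \<Rightarrow> bool" where
  "seq_compact_wrt T S \<longleftrightarrow>
     (\<forall>x::nat \<Rightarrow> 'a. range x \<subseteq> S \<longrightarrow>
        (\<exists>r l. strict_mono r \<and> limitin T (x \<circ> r) l sequentially))"

definition edom :: "('a \<Rightarrow> ereal) \<Rightarrow> 'a set" where
  "edom h = {u. h u < \<infinity>}"

definition proper_fun :: "('a \<Rightarrow> ereal) \<Rightarrow> bool" where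
  "proper_fun h \<longleftrightarrow> edom h \<noteq> {} \<and> (\<forall>u. h u \<noteq> -\<infinity>)"

definition econvex :: "('a::real_vector \<Rightarrow> ereal) \<Rightarrow> bool" where
  "econvex h \<longleftrightarrow>
     (\<forall>u v t. 0 \<le> t \<and> t \<le> 1 \<longrightarrow>
        h ((1 - t) *\<^sub>R u + t *\<^sub>R v) \<le> ereal (1 - t) * h u + ereal t * h v)"

definition subdifferential ::
    "('u::real_normed_vector \<Rightarrow> ereal) \<Rightarrow> 'u \<Rightarrow> ('u \<Rightarrow>\<^sub>L real) set" where
  "subdifferential h u =
     {\<xi>. u \<in> edom h \<and> (\<forall>v. h u + ereal (blinfun_apply \<xi> (v - u)) \<le> h v)}"

text \<open>Only used with \<open>h u\<close> finite. For \<open>h v = \<infinity>\<close> the value is \<open>\<infinity>\<close>, so an upper bound by a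
  Bregman distance says nothing at points outside \<open>edom h\<close>.\<close>

definition bregman ::
    "('u::real_normed_vector \<Rightarrow> ereal) \<Rightarrow> ('u \<Rightarrow>\<^sub>L real) \<Rightarrow> 'u \<Rightarrow> 'u \<Rightarrow> ereal" where
  "bregman h \<xi> v u = h v - h u - ereal (blinfun_apply \<xi> (v - u))"

definition tikhonov ::
    "('u \<Rightarrow> 'h::real_normed_vector) \<Rightarrow> ('u \<Rightarrow> ereal) \<Rightarrow> 'h \<Rightarrow> real \<Rightarrow> 'u \<Rightarrow> ereal" where
  "tikhonov F h y \<alpha> u = ereal (1/2 * (norm (F u - y))\<^sup>2) + ereal \<alpha> * h u"

definition minimizer_on :: "('a \<Rightarrow> ereal) \<Rightarrow> 'a set \<Rightarrow> 'a \<Rightarrow> bool" where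
  "minimizer_on f S u \<longleftrightarrow> u \<in> S \<and> (\<forall>v\<in>S. f u \<le> f v)"

definition h_minimizing_solution ::
    "'u set \<Rightarrow> ('u \<Rightarrow> 'h) \<Rightarrow> ('u \<Rightarrow> ereal) \<Rightarrow> 'h \<Rightarrow> 'u \<Rightarrow> bool" where
  "h_minimizing_solution D F h y u \<longleftrightarrow>
     u \<in> edom h \<and> minimizer_on h {v \<in> D. F v = y} u"

text \<open>Directional difference quotients are taken along those \<open>t \<rightarrow> 0\<close> with \<open>u + t v \<in> D\<close>.
  At interior points of \<open>D\<close> this is the usual two-sided Gateaux derivative, with a bounded linear
  operator as derivative; at boundary points it is relative to \<open>D\<close>.\<close>

definition has_gateaux_derivative_within ::
    "('u::real_normed_vector \<Rightarrow> 'h::real_normed_vector) \<Rightarrow> ('u \<Rightarrow>\<^sub>L 'h) \<Rightarrow> 'u \<Rightarrow> 'u set \<Rightarrow> bool" where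
  "has_gateaux_derivative_within F A u D \<longleftrightarrow>
     (\<forall>v. ((\<lambda>t. F (u + t *\<^sub>R v)) has_vector_derivative blinfun_apply A v)
            (at 0 within {t. u + t *\<^sub>R v \<in> D}))"

end

theory Submission
  imports Defs
begin

text \<open>Comparing \<open>J\<^sub>\<alpha>\<close> at \<open>u\<^sub>\<alpha>\<close> and at \<open>ubar\<close> bounds \<open>r\<^sup>2/2 + \<alpha> D\<close>, where \<open>r\<close> is the residual and \<open>D\<close>
  the Bregman distance, by \<open>-\<alpha>\<langle>\<omega>, F'(ubar)(u\<^sub>\<alpha> - ubar)\<rangle>\<close>. The nonlinearity
  assumption bounds this in turn by \<open>\<alpha> \<parallel>\<omega>\<parallel> (c D + r)\<close>. As \<open>c \<parallel>\<omega>\<parallel> < 1\<close>, the term in \<open>D\<close> is absorbed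
  on the left, which gives the rates with the constant 2 in place of 4.\<close>

text \<open>Both rates are read off from this single inequality between real numbers: dropping the
  term in \<open>B\<close> bounds the residual, dropping the square bounds \<open>B\<close>.\<close>

lemma tikhonov_source_estimate:
  fixes A :: "'u::real_normed_vector \<Rightarrow>\<^sub>L 'h::real_normed_vector"
  assumes "\<alpha> > 0"
    and finite: "h u \<noteq> -\<infinity>" "\<bar>h v\<bar> \<noteq> \<infinity>"
    and tikhonov_le: "tikhonov F h (F v) \<alpha> u \<le> tikhonov F h (F v) \<alpha> v"
    and estimate: "ereal (norm (F u - F v - A (u - v)))
      \<le> ereal c * bregman h (dual_adjoint A \<omega>) u v"
  obtains B where "bregman h (dual_adjoint A \<omega>) u v = ereal B"
    and "(norm (F u - F v))\<^sup>2 / 2 + \<alpha> * (1 - c * norm \<omega>) * B \<le> \<alpha> * norm \<omega> * norm (F u - F v)"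
proof -
  obtain b where b: "h v = ereal b"
    using finite by auto
  \<comment> \<open>If \<open>h u\<close> were infinite, the functional would be infinite at
    \<open>u\<close> because \<alpha> is positive, but it is finite at \<open>v\<close>.\<close>
  obtain a where a: "h u = ereal a"
    using finite tikhonov_le \<open>\<alpha> > 0\<close> by (cases "h u") (auto simp: tikhonov_def b)
  define r where "r = norm (F u - F v)"
  define B where "B = a - b - \<omega> (A (u - v))"
  have B: "bregman h (dual_adjoint A \<omega>) u v = ereal B"
    by (simp add: bregman_def dual_adjoint_def a b B_def)
  have "norm (F u - F v - A (u - v)) \<le> c * B"
    using estimate by (simp add: B)
  then have "norm (A (u - v)) \<le> c * B + r"
    using norm_triangle_sub[of "A (u - v)" "F u - F v"] by (simp add: r_def norm_minus_commute)
  then have "norm \<omega> * norm (A (u - v)) \<le> norm \<omega> * (c * B + r)"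
    by (rule mult_left_mono) simp
  then have "- \<omega> (A (u - v)) \<le> norm \<omega> * (c * B + r)"
    using norm_blinfun[of \<omega> "A (u - v)"] by simp
  \<comment> \<open>The source condition makes the linear part of the Bregman distance equal to
    \<omega> applied to \<open>A (u - v)\<close>, so the left side is exactly its negative.\<close>
  then have "B - a + b \<le> norm \<omega> * (c * B + r)"
    by (simp add: B_def)
  then have "\<alpha> * (B - a + b) \<le> \<alpha> * (norm \<omega> * (c * B + r))"
    using \<open>\<alpha> > 0\<close> by (simp add: mult_left_mono)
  \<comment> \<open>The data is \<open>F v\<close>, so the residual at \<open>v\<close> vanishes and
    only the penalty remains on the right. Adding the previous bound cancels \<open>a\<close> and
    \<open>b\<close>.\<close>
  moreover have "r\<^sup>2 / 2 + \<alpha> * a \<le> \<alpha> * b"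
    using tikhonov_le by (simp add: tikhonov_def a b r_def)
  ultimately have "r\<^sup>2 / 2 + \<alpha> * (1 - c * norm \<omega>) * B \<le> \<alpha> * norm \<omega> * r"
    by (simp add: algebra_simps)
  with B show thesis
    using that by (simp add: r_def)
qed

text \<open>A rearranged subgradient inequality; it provides the sign that allows the Bregman term
  to be discarded when bounding the residual.\<close>

lemma bregman_nonneg:
  assumes "\<xi> \<in> subdifferential h v" "\<bar>h v\<bar> \<noteq> \<infinity>"
  shows "0 \<le> bregman h \<xi> u v"
proof -
  have "h v + ereal (\<xi> (u - v)) \<le> h u"
    using assms by (auto simp: subdifferential_def)
  then show ?thesis
    using assms(2) by (cases "h u"; cases "h v") (auto simp: bregman_def)
qed

theorem theorem3p3:
  fixes \<tau>U :: "'u::banach topology"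
    and \<tau>H :: "'h::banach topology"
    and D :: "'u set"
    and F :: "'u \<Rightarrow> 'h"
    and F' :: "'u \<Rightarrow> ('u \<Rightarrow>\<^sub>L 'h)"
    and h :: "'u \<Rightarrow> ereal"
    and y :: 'h
    and ubar u\<alpha> :: 'u
    and \<xi> :: "'u \<Rightarrow>\<^sub>L real"
    and \<omega> :: "'h \<Rightarrow>\<^sub>L real"
    and \<rho> c \<alpha> :: real
  assumes A1_U: "coarser_than_norm \<tau>U"
    and A1_H: "coarser_than_norm \<tau>H"
    and A3: "seq_lsc_wrt \<tau>H (\<lambda>z. ereal (norm z))"
    and A4_interior: "interior D \<noteq> {}"
    and A4_closed: "closedin \<tau>U D"
    and A4_dom: "D \<inter> edom h \<noteq> {}"
    and A5: "continuous_map (subtopology \<tau>U D) \<tau>H F"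
    and A6_nonneg: "\<forall>u. 0 \<le> h u"
    and A6_proper: "proper_fun h"
    and A6_convex: "econvex h"
    and A6_bdd_below: "\<exists>m::real. \<forall>u. ereal m \<le> h u"
    and A6_lsc: "lsc_wrt \<tau>U h"
    and A7: "\<forall>M>0. \<forall>\<beta>>0. seq_compact_wrt \<tau>U {u \<in> D. tikhonov F h y \<beta> u \<le> ereal M}"
    and N_solution: "h_minimizing_solution D F h y ubar"
    and N_gateaux: "\<forall>u\<in>D. has_gateaux_derivative_within F (F' u) u D"
    and N_rho: "\<rho> > 0"
    and N_c: "c > 0"
    and N_subgradient: "\<xi> \<in> subdifferential h ubar"
    and N_estimate: "\<forall>u \<in> D \<inter> ball ubar \<rho>.
          ereal (norm (F u - F ubar - blinfun_apply (F' ubar) (u - ubar)))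
            \<le> ereal c * bregman h \<xi> u ubar"
    and source: "\<xi> = dual_adjoint (F' ubar) \<omega>"
    and source_small: "c * norm \<omega> < 1"
    and alpha_pos: "\<alpha> > 0"
    and minimizer: "minimizer_on (tikhonov F h y \<alpha>) D u\<alpha>"
    and minimizer_in_ball: "u\<alpha> \<in> ball ubar \<rho>"
  shows "norm (F u\<alpha> - F ubar) \<le> 4 * \<alpha> * norm \<omega> \<and>
         bregman h (dual_adjoint (F' ubar) \<omega>) u\<alpha> ubar
           \<le> ereal (4 * \<alpha> * (norm \<omega>)\<^sup>2 / (1 - c * norm \<omega>))"
proof -
  have sol: "ubar \<in> D" "F ubar = y" "h ubar < \<infinity>"
    using N_solution by (auto simp: h_minimizing_solution_def minimizer_on_def edom_def)
  have no_minus_inf: "h u \<noteq> -\<infinity>" for u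
    using A6_proper by (simp add: proper_fun_def)
  have fin: "\<bar>h ubar\<bar> \<noteq> \<infinity>"
    using sol(3) no_minus_inf[of ubar] by auto
  have min: "u\<alpha> \<in> D" "tikhonov F h (F ubar) \<alpha> u\<alpha> \<le> tikhonov F h (F ubar) \<alpha> ubar"
    using minimizer sol by (auto simp: minimizer_on_def)
  \<comment> \<open>The nonlinearity estimate is only local; it applies here because the minimizer
    lies in the ball around \<open>ubar\<close>.\<close>
  have est: "ereal (norm (F u\<alpha> - F ubar - F' ubar (u\<alpha> - ubar)))
      \<le> ereal c * bregman h (dual_adjoint (F' ubar) \<omega>) u\<alpha> ubar"
    using N_estimate min(1) minimizer_in_ball source by simp
  define r k where "r = norm (F u\<alpha> - F ubar)" and "k = 1 - c * norm \<omega>"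
  obtain B where B: "bregman h (dual_adjoint (F' ubar) \<omega>) u\<alpha> ubar = ereal B"
    and main: "r\<^sup>2 / 2 + \<alpha> * k * B \<le> \<alpha> * norm \<omega> * r"
    unfolding r_def k_def
    by (rule tikhonov_source_estimate[OF alpha_pos no_minus_inf fin min(2) est])
  have "0 \<le> B"
    using bregman_nonneg[OF N_subgradient fin, of u\<alpha>] B source by simp
  have "0 < k" "0 \<le> r"
    using source_small by (simp_all add: k_def r_def)
  have "0 \<le> \<alpha> * k * B"
    using alpha_pos \<open>0 < k\<close> \<open>0 \<le> B\<close> by simp
  with main have "r * r \<le> (2 * \<alpha> * norm \<omega>) * r"
    by (simp add: power2_eq_square)
  \<comment> \<open>One factor \<open>r\<close> cancels when it is nonzero; for \<open>r = 0\<close>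
    the bound is trivial.\<close>
  then have r_le: "r \<le> 2 * \<alpha> * norm \<omega>"
    using alpha_pos \<open>0 \<le> r\<close> by (cases "r = 0") (auto simp: mult_le_cancel_right)
  \<comment> \<open>Now the square is dropped instead. After cancelling \<alpha>, the residual bound
    turns \<open>r\<close> into the second factor \<open>norm \<omega>\<close>.\<close>
  have "\<alpha> * (k * B) \<le> \<alpha> * (norm \<omega> * r)"
    using main zero_le_power2[of r] unfolding mult.assoc by linarith
  then have "k * B \<le> norm \<omega> * r"
    using alpha_pos by simp
  also have "\<dots> \<le> norm \<omega> * (2 * \<alpha> * norm \<omega>)"
    using r_le by (rule mult_left_mono) simp
  \<comment> \<open>The constant 2 is relaxed to 4 here, and likewise for the residual
    below.\<close>
  also have "\<dots> \<le> 4 * \<alpha> * (norm \<omega>)\<^sup>2"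
    using alpha_pos by (simp add: power2_eq_square)
  finally have "B \<le> 4 * \<alpha> * (norm \<omega>)\<^sup>2 / k"
    using \<open>0 < k\<close> by (simp add: pos_le_divide_eq mult.commute)
  moreover have "r \<le> 4 * \<alpha> * norm \<omega>"
    using r_le \<open>0 \<le> r\<close> by simp
  ultimately show ?thesis
    by (simp add: B r_def k_def)
qed

end
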